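(* Let $\rho\in\mathbb{N}$, and let $\delta_1,\dots,\delta_\rho\in(-1,+\infty)$ and $\kappa_1,\dots,\kappa_\rho\in\mathbb{Z}_+$ be arbitrary parameters. The following statements hold. (i) Let $c$ with $0<c<\frac12$ and $\alpha,\beta\in(-1,+\infty)$ with $\alpha+\beta>-1$ be given. Then for all $t,x\in\mathbb{C}$ with $|t|<c$ and $|x|<\frac{1}{4c}-\frac12$, $$(1-t)^{-\alpha-\beta-1}\,{}_{\rho+2}F_{\rho+1}\left(\tfrac{\alpha+\beta+1}{2},\tfrac{\alpha+\beta+2}{2},\delta_1+1,\dots,\delta_\rho+1;\ \alpha+1,\kappa_1+\delta_1+1,\dots,\kappa_\rho+\delta_\rho+1;\ -\frac{4xt}{(1-t)^2}\right)$$ $$=\sum_{n=0}^\infty\frac{(\alpha+\beta+1)_n}{n!}\,\mathcal{P}_n(x;\alpha,\beta,\delta_1,\dots,\delta_\rho,\kappa_1,\dots,\kappa_\rho)\,t^n.$$ (ii) Let $\alpha>-1$. Then for all $t,x\in\mathbb{C}$, $$e^t\,{}_{\rho}F_{\rho+1}\left(\delta_1+1,\dots,\delta_\rho+1;\ \alpha+1,\kappa_1+\delta_1+1,\dots,\kappa_\rho+\delta_\rho+1;\ -xt\right)=\sum_{n=0}^\infty\mathcal{L}_n(x;\alpha,\delta_1,\dots,\delta_\rho,\kappa_1,\dots,\kappa_\rho)\,\frac{t^n}{n!}.$$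
   Context: $\mathbb{N}$ is the set of positive integers, $\mathbb{Z}_+$ the set of non-negative integers. The Pochhammer symbol is $(c)_0=1$, $(c)_k=c(c+1)\cdots(c+k-1)$ for $k\ge1$. The generalized hypergeometric function is $${}_mF_n(a_1,\dots,a_m;b_1,\dots,b_n;x)=\sum_{k=0}^\infty\frac{(a_1)_k\cdots(a_m)_k}{(b_1)_k\cdots(b_n)_k}\frac{x^k}{k!};$$ when an upper parameter is $-n$ with $n\in\mathbb{Z}_+$ it is a polynomial in $x$ (sum over $0\le k\le n$). Powers of $1-t$ are principal branches (equal to $1$ at $t=0$). For $n\in\mathbb{Z}_+$, define $$\mathcal{P}_n(x;\alpha,\beta,\delta_1,\dots,\delta_\rho,\kappa_1,\dots,\kappa_\rho)={}_{\rho+2}F_{\rho+1}(-n,n+\alpha+\beta+1,\delta_1+1,\dots,\delta_\rho+1;\alpha+1,\kappa_1+\delta_1+1,\dots,\kappa_\rho+\delta_\rho+1;x),$$ $$\mathcal{L}_n(x;\alpha,\delta_1,\dots,\delta_\rho,\kappa_1,\dots,\kappa_\rho)={}_{\rho+1}F_{\rho+1}(-n,\delta_1+1,\dots,\delta_\rho+1;\alpha+1,\kappa_1+\delta_1+1,\dots,\kappa_\rho+\delta_\rho+1;x).$$ *)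

theory Defs
  imports "HOL-Analysis.Analysis"
begin

definition hypergeo :: "complex list \<Rightarrow> complex list \<Rightarrow> complex \<Rightarrow> complex" where
  "hypergeo as bs x = eval_fps (fps_hypergeo as bs 1) x"

lemma foldl_mult_eq_prod_list:
  fixes f :: "'b \<Rightarrow> 'a :: comm_monoid_mult"
  shows "foldl (\<lambda>r a. r * f a) v as = v * (\<Prod>a\<leftarrow>as. f a)"
  by (induction as arbitrary: v) (simp_all add: mult_ac)

lemma hypergeo_altdef:
  "hypergeo as bs x =
     (\<Sum>k. (\<Prod>a\<leftarrow>as. pochhammer a k) / (\<Prod>b\<leftarrow>bs. pochhammer b k) * (x ^ k / fact k))"
  by (simp add: hypergeo_def eval_fps_def foldl_mult_eq_prod_list)

lemma hypergeo_minus_nat: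
  assumes "- of_nat n \<in> set as"
  shows "hypergeo as bs x =
     (\<Sum>k\<le>n. (\<Prod>a\<leftarrow>as. pochhammer a k) / (\<Prod>b\<leftarrow>bs. pochhammer b k) * (x ^ k / fact k))"
proof -
  have "(\<Prod>a\<leftarrow>as. pochhammer a k) = 0" if "k > n" for k
  proof -
    have "pochhammer (- of_nat n :: complex) k = 0"
      using that by (rule pochhammer_of_nat_eq_0_lemma)
    hence "0 \<in> set (map (\<lambda>a. pochhammer a k) as)"
      using assms by (metis (mono_tags, lifting) image_eqI list.set_map)
    thus ?thesis
      by (simp only: prod_list_zero_iff)
  qed
  thus ?thesis
    unfolding hypergeo_altdef by (intro suminf_finite) auto
qed

text \<open>
  The parameters \<^term>\<open>\<delta>\<close> and \<^term>\<open>\<kappa>\<close> are families indexed by \<open>1, \<dots>, \<rho>\<close>; their values at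
  other indices are irrelevant.
\<close>

definition upper_params :: "nat \<Rightarrow> (nat \<Rightarrow> real) \<Rightarrow> complex list" where
  "upper_params \<rho> \<delta> = map (\<lambda>j. of_real (\<delta> j + 1)) [1..<Suc \<rho>]"

definition lower_params :: "nat \<Rightarrow> (nat \<Rightarrow> real) \<Rightarrow> (nat \<Rightarrow> nat) \<Rightarrow> complex list" where
  "lower_params \<rho> \<delta> \<kappa> = map (\<lambda>j. of_real (of_nat (\<kappa> j) + \<delta> j + 1)) [1..<Suc \<rho>]"

definition gen_jacobi ::
  "nat \<Rightarrow> complex \<Rightarrow> real \<Rightarrow> real \<Rightarrow> nat \<Rightarrow> (nat \<Rightarrow> real) \<Rightarrow> (nat \<Rightarrow> nat) \<Rightarrow> complex" where
  "gen_jacobi n x \<alpha> \<beta> \<rho> \<delta> \<kappa> =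
     hypergeo (- of_nat n # of_real (of_nat n + \<alpha> + \<beta> + 1) # upper_params \<rho> \<delta>)
              (of_real (\<alpha> + 1) # lower_params \<rho> \<delta> \<kappa>) x"

definition gen_laguerre ::
  "nat \<Rightarrow> complex \<Rightarrow> real \<Rightarrow> nat \<Rightarrow> (nat \<Rightarrow> real) \<Rightarrow> (nat \<Rightarrow> nat) \<Rightarrow> complex" where
  "gen_laguerre n x \<alpha> \<rho> \<delta> \<kappa> =
     hypergeo (- of_nat n # upper_params \<rho> \<delta>)
              (of_real (\<alpha> + 1) # lower_params \<rho> \<delta> \<kappa>) x"

end

(* Since (-n)_k / n! = (-1)^k / (n-k)! and (s)_n (n+s)_k = (s)_{n+k} with s = alpha + beta + 1,
   the right-hand side of (i) is a sum over pairs k \<le> n. Summing over n = k + m first gives a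
   binomial series, sum_m (s+2k)_m t^m / m! = (1-t)^(-s-2k), and (s)_{2k} = 4^k (s/2)_k ((s+1)/2)_k
   turns what remains into the hypergeometric series on the left. The interchange is justified by
   absolute convergence: the ratios (delta_j+1)_k / (kappa_j+delta_j+1)_k are at most 1, and
   4 |x| |t| < 1 - 2c \<le> (1-|t|)^2. Part (ii) is the Cauchy product of the exponential series
   with the hypergeometric series on its left. *)
theory Submission
  imports Defs "HOL-Real_Asymp.Real_Asymp"
begin

section \<open>Rearrangement of double series\<close>

text \<open>Summability of the row sums \<open>h\<close> of the norms makes the double family
  absolutely summable, so it may be summed by rows or along antidiagonals with the same total.
  Keeping \<open>h\<close> explicit lets the rows be evaluated in closed form first and compared
  with a majorant afterwards.\<close>

lemma sums_antidiagonals: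
  fixes f :: "nat \<Rightarrow> nat \<Rightarrow> 'a :: banach"
  assumes f: "\<And>k. f k sums g k"
    and norm_f: "\<And>k. (\<lambda>m. norm (f k m)) sums h k"
    and h: "summable h"
  shows "summable g" and "(\<lambda>n. \<Sum>k\<le>n. f k (n - k)) sums (\<Sum>k. g k)"
proof -
  have norm_row: "((\<lambda>m. norm (f k m)) has_sum h k) UNIV" for k
    using norm_f[of k] by (intro norm_summable_imp_has_sum) (simp_all add: sums_iff)
  have h_nonneg: "h k \<ge> 0" for k
    using norm_row by (rule has_sum_nonneg) auto
  have "h summable_on UNIV"
    using h h_nonneg by (simp add: summable_on_UNIV_nonneg_real_iff)
  hence "(\<lambda>p. norm (case p of (k, m) \<Rightarrow> f k m)) summable_on (SIGMA k:UNIV. UNIV)"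
    using norm_row by (intro summable_on_SigmaI[where g = h]) auto
  hence summable: "(\<lambda>(k,m). f k m) summable_on UNIV \<times> UNIV"
    by (rule abs_summable_summable)
  define S where "S = infsum (\<lambda>(k,m). f k m) (UNIV \<times> UNIV)"
  have S: "((\<lambda>(k,m). f k m) has_sum S) (UNIV \<times> UNIV)"
    unfolding S_def using summable by (rule has_sum_infsum)
  have row: "((\<lambda>m. f k m) has_sum g k) UNIV" for k
    using norm_f[of k] f[of k] by (intro norm_summable_imp_has_sum) (auto simp: sums_iff)
  have "(g has_sum S) UNIV"
    using S by (rule has_sum_SigmaD) (simp add: row)
  hence "g sums S"
    by (rule has_sum_imp_sums)
  thus "summable g"
    by (rule sums_summable)
  have g: "(\<Sum>k. g k) = S"
    using \<open>g sums S\<close> by (rule sums_unique[symmetric])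
  \<comment> \<open>The substitution n = k + m identifies all pairs (k, m) with the pairs k \<le> n,
    on which the truncated difference \<open>n - k\<close> is the true one.\<close>
  have "((\<lambda>(n,k). f k (n - k)) has_sum S) (SIGMA n:UNIV. {..n}) \<longleftrightarrow>
        ((\<lambda>(k,m). f k m) has_sum S) (UNIV \<times> UNIV)"
    by (rule has_sum_reindex_bij_witness
          [where i = "\<lambda>(k,m). (k + m, k)" and j = "\<lambda>(n,k). (k, n - k)"]) auto
  with S have "((\<lambda>(n,k). f k (n - k)) has_sum S) (SIGMA n:UNIV. {..n})"
    by simp
  hence "((\<lambda>n. \<Sum>k\<le>n. f k (n - k)) has_sum S) UNIV"
    by (rule has_sum_SigmaD) (auto intro: has_sum_finite)
  thus "(\<lambda>n. \<Sum>k\<le>n. f k (n - k)) sums (\<Sum>k. g k)"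
    unfolding g by (rule has_sum_imp_sums)
qed

section \<open>Binomial series and Pochhammer identities\<close>

text \<open>This is the binomial series with exponent \<open>-a\<close> at \<open>-t\<close>, since
  (a)_m / m! is (-1)^m times the binomial coefficient of \<open>-a\<close> over
  \<open>m\<close>.\<close>

lemma pochhammer_powr_sums:
  fixes a t :: complex
  assumes "norm t < 1"
  shows "(\<lambda>m. pochhammer a m / fact m * t ^ m) sums ((1 - t) powr (- a))"
  using gen_binomial_complex[of "- t" "- a"] assms
  by (simp add: gbinomial_pochhammer mult_ac flip: power_mult_distrib)

text \<open>The real counterpart, applied at \<open>norm t\<close> to evaluate sums of
  norms.\<close>

lemma pochhammer_powr_sums_real:
  fixes a t :: real
  assumes "\<bar>t\<bar> < 1"
  shows "(\<lambda>m. pochhammer a m / fact m * t ^ m) sums ((1 - t) powr (- a))"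
  using gen_binomial_real[of "- t" "- a"] assms
  by (simp add: gbinomial_pochhammer mult_ac flip: power_mult_distrib)

lemma pochhammer_mono:
  fixes a b :: real
  assumes "0 \<le> a" "a \<le> b"
  shows "pochhammer a k \<le> pochhammer b k"
  using assms unfolding pochhammer_prod by (intro prod_mono) auto

lemma norm_pochhammer_of_real:
  assumes "a > 0"
  shows "norm (pochhammer (of_real a :: complex) k) = pochhammer a k"
  using pochhammer_pos[OF assms, of k] by (simp add: pochhammer_of_real)

text \<open>Up to sign, the \<open>k\<close> factors are n, n - 1, ..., n - k + 1, the largest
  factors of n!.\<close>

lemma pochhammer_minus_of_nat:
  assumes "k \<le> n"
  shows "pochhammer (- of_nat n :: 'a :: field_char_0) k = (- 1) ^ k * fact n / fact (n - k)"
proof -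
  have "of_nat n - of_nat k + 1 = (of_nat (n - k) + 1 :: 'a)"
    using assms by (simp add: of_nat_diff)
  moreover have "(fact n :: 'a) = fact (n - k) * pochhammer (1 + of_nat (n - k)) k"
    using assms pochhammer_product'[of "1::'a" "n - k" k] by (simp add: pochhammer_fact)
  ultimately show ?thesis
    by (simp add: pochhammer_minus add.commute)
qed

text \<open>Separate the factors s + i with even and odd i and take 2 out of each.\<close>

lemma pochhammer_double_half:
  fixes s :: "'a :: field_char_0"
  shows "pochhammer s (2 * k) = 4 ^ k * (pochhammer (s / 2) k * pochhammer ((s + 1) / 2) k)"
  using pochhammer_double[of "s / 2" k] by (simp add: power_mult add_divide_distrib)

section \<open>Convergence of the majorants\<close>

text \<open>The ratio of consecutive coefficients tends to 1, so the radius of convergence is 1.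
  This series majorizes the Jacobi case.\<close>

lemma summable_2F1:
  fixes p q a y :: real
  assumes "p > 0" "q > 0" "a > 0" "\<bar>y\<bar> < 1"
  shows "summable (\<lambda>k. pochhammer p k * pochhammer q k / (pochhammer a k * fact k) * y ^ k)"
proof -
  define f where "f k = pochhammer p k * pochhammer q k / (pochhammer a k * fact k)" for k
  have "(\<lambda>k. (a + real k) * (1 + real k) / ((p + real k) * (q + real k))) \<longlonglongrightarrow> 1"
    by real_asymp
  moreover have "norm (f k) / norm (f (Suc k))
                   = (a + real k) * (1 + real k) / ((p + real k) * (q + real k))" for k
  proof -
    have "f (Suc k) = f k * ((p + real k) * (q + real k) / ((a + real k) * (1 + real k)))"
      by (simp add: f_def pochhammer_Suc mult_ac)
    moreover have "f k > 0"
      unfolding f_def using assms by (intro divide_pos_pos mult_pos_pos pochhammer_pos) auto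
    ultimately show ?thesis
      using assms by (simp add: abs_mult)
  qed
  ultimately have "conv_radius f = ereal 1"
    by (intro conv_radius_ratio_limit_nonzero) auto
  thus ?thesis
    using summable_in_conv_radius[of y f] assms by (simp add: f_def)
qed

text \<open>The ratio of a coefficient to the next one tends to infinity, so the series is entire.
  It majorizes the Laguerre case.\<close>

lemma summable_0F1:
  fixes a y :: real
  assumes "a > 0"
  shows "summable (\<lambda>k. 1 / (pochhammer a k * fact k) * y ^ k)"
proof -
  define f where "f k = 1 / (pochhammer a k * fact k)" for k
  have "filterlim (\<lambda>k. (a + real k) * (1 + real k)) at_top sequentially"
    by real_asymp
  moreover have "norm (f k) / norm (f (Suc k)) = (a + real k) * (1 + real k)" for k
    using assms pochhammer_pos[of a k]
    by (simp add: f_def pochhammer_Suc abs_mult field_simps)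
  ultimately have "(\<lambda>k. ereal (norm (f k) / norm (f (Suc k)))) \<longlonglongrightarrow> \<infinity>"
    by (simp add: tendsto_PInfty_eq_at_top)
  hence "conv_radius f = \<infinity>"
    by (intro conv_radius_ratio_limit_ereal_nonzero) auto
  thus ?thesis
    using summable_in_conv_radius[of y f] by (simp add: f_def)
qed

section \<open>Generating functions with general coefficients\<close>

text \<open>The sequence \<open>c\<close> stands for the quotient of the remaining Pochhammer
  products, and its bound reduces convergence to a 2F1 series. The condition on \<open>x\<close> and
  \<open>t\<close> says that the argument of that series, 4 |x| |t| / (1 - |t|)^2, is below
  1.\<close>

lemma jacobi_generating_function:
  fixes c :: "nat \<Rightarrow> complex" and s a :: real and t x :: complex
  assumes s: "s > 0" and a: "a > 0" and c: "\<And>k. norm (c k) \<le> 1 / pochhammer a k"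
    and t: "norm t < 1" and xt: "4 * norm x * norm t < (1 - norm t)\<^sup>2"
  shows "(\<lambda>n. pochhammer (of_real s) n / fact n *
              (\<Sum>k\<le>n. pochhammer (- of_nat n) k * pochhammer (of_nat n + of_real s) k
                        * c k * (x ^ k / fact k)) * t ^ n)
         sums ((1 - t) powr (- of_real s) *
              (\<Sum>k. pochhammer (of_real s / 2) k * pochhammer ((of_real s + 1) / 2) k
                     * c k * ((- (4 * x * t / (1 - t)\<^sup>2)) ^ k / fact k)))"
proof -
  define S where "S = complex_of_real s"
  \<comment> \<open>The term of the right-hand side with n = k + m contains (s)_{2k+m} = (s)_{2k}
    (s+2k)_m. \<open>d k\<close> collects what does not depend on \<open>m\<close>, so each row of
    \<open>f\<close> is a multiple of a binomial series.\<close>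
  define d where "d k = c k * ((- (x * t)) ^ k / fact k) * pochhammer S (2 * k)" for k
  define f where
    "f k m = d k * (pochhammer (S + of_nat (2 * k)) m / fact m * t ^ m)" for k m
  define g where
    "g k = pochhammer (S / 2) k * pochhammer ((S + 1) / 2) k
             * c k * ((- (4 * x * t / (1 - t)\<^sup>2)) ^ k / fact k)" for k
  define h where "h k = norm (d k) * (1 - norm t) powr (- (s + real (2 * k)))" for k
  define y where "y = 4 * norm x * norm t / (1 - norm t)\<^sup>2"
  have t1: "1 - t \<noteq> 0" using t by auto
  have y: "\<bar>y\<bar> < 1" using xt t by (simp add: y_def abs_mult)

  have rows: "f k sums ((1 - t) powr (- S) * g k)" for k
  proof -
    have "f k sums (d k * (1 - t) powr (- (S + of_nat (2 * k))))"
      unfolding f_def by (intro sums_mult pochhammer_powr_sums t)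
    \<comment> \<open>Splitting off the integer exponent 2k is exact for the principal
      branch.\<close>
    also have "(1 - t) powr (- (S + of_nat (2 * k))) = (1 - t) powr (- S) / (1 - t) ^ (2 * k)"
      using t1 powr_diff[of "1 - t" "- S" "of_nat (2 * k)"] by (simp add: powr_nat' del: of_nat_mult)
    also have "d k * \<dots> = (1 - t) powr (- S) * g k"
    proof -
      have "- (4 * x * t / (1 - t)\<^sup>2) = 4 * (- (x * t)) / (1 - t)\<^sup>2"
        by simp
      hence "(- (4 * x * t / (1 - t)\<^sup>2)) ^ k = 4 ^ k * (- (x * t)) ^ k / (1 - t) ^ (2 * k)"
        by (simp only: power_divide power_mult_distrib power_mult)
      thus ?thesis
        unfolding d_def g_def pochhammer_double_half by (simp add: mult_ac)
    qed
    finally show ?thesis .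
  qed

  have norm_rows: "(\<lambda>m. norm (f k m)) sums h k" for k
  proof -
    \<comment> \<open>As s + 2k is a positive real, taking norms leaves its Pochhammer symbols
      unchanged, and the row of norms is again a binomial series, now at
      \<open>norm t\<close>.\<close>
    have S: "S + of_nat (2 * k) = of_real (s + real (2 * k))"
      by (simp add: S_def)
    have "(\<lambda>m. norm (d k) * (pochhammer (s + real (2 * k)) m / fact m * norm t ^ m)) sums h k"
      unfolding h_def using t by (intro sums_mult pochhammer_powr_sums_real) auto
    moreover have "norm (f k m)
        = norm (d k) * (pochhammer (s + real (2 * k)) m / fact m * norm t ^ m)" for m
      unfolding f_def S using s
      by (simp only: norm_mult norm_divide norm_power norm_fact) (subst norm_pochhammer_of_real, auto)
    ultimately show ?thesis by simp
  qed

  \<comment> \<open>The duplication formula supplies the factor 4^k in \<open>norm (d k)\<close>,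
    and (1 - |t|)^(-2k) comes from the row sum; together with (|x| |t|)^k they form
    \<open>y ^ k\<close>.\<close>
  have "summable h"
  proof (rule summable_comparison_test)
    show "summable (\<lambda>k. (1 - norm t) powr (- s) *
            (pochhammer (s / 2) k * pochhammer ((s + 1) / 2) k / (pochhammer a k * fact k) * y ^ k))"
      using s a y by (intro summable_mult summable_2F1) auto
    have "norm (h k) \<le> (1 - norm t) powr (- s) *
            (pochhammer (s / 2) k * pochhammer ((s + 1) / 2) k / (pochhammer a k * fact k) * y ^ k)"
      for k
    proof -
      define P where "P = pochhammer (s / 2) k * pochhammer ((s + 1) / 2) k"
      have P: "P \<ge> 0"
        unfolding P_def using s by (intro mult_nonneg_nonneg pochhammer_nonneg) auto
      have "(1 - norm t) powr (- (s + real (2 * k))) = (1 - norm t) powr (- s) / (1 - norm t) ^ (2 * k)"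
        using t powr_diff[of "1 - norm t" "- s" "real (2 * k)"]
        by (simp add: powr_realpow del: of_nat_mult)
      moreover have "norm (d k) = norm (c k) * ((4 * norm x * norm t) ^ k / fact k * P)"
      proof -
        have "norm (pochhammer S (2 * k)) = 4 ^ k * P"
          unfolding S_def P_def norm_pochhammer_of_real[OF s] by (rule pochhammer_double_half)
        thus ?thesis
          by (simp add: d_def norm_mult norm_divide norm_power power_mult_distrib)
      qed
      moreover have "y ^ k = (4 * norm x * norm t) ^ k / (1 - norm t) ^ (2 * k)"
        by (simp only: y_def power_divide power_mult)
      ultimately have "norm (h k) = norm (c k) * ((1 - norm t) powr (- s) * (P * y ^ k / fact k))"
        using t P by (simp add: h_def abs_mult mult_ac)
      also have "\<dots> \<le> 1 / pochhammer a k * ((1 - norm t) powr (- s) * (P * y ^ k / fact k))"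
        by (intro mult_right_mono c mult_nonneg_nonneg divide_nonneg_nonneg P)
           (auto simp: y_def)
      finally show ?thesis
        by (simp add: P_def mult_ac)
    qed
    thus "\<exists>N. \<forall>k\<ge>N. norm (h k) \<le> (1 - norm t) powr (- s) *
            (pochhammer (s / 2) k * pochhammer ((s + 1) / 2) k / (pochhammer a k * fact k) * y ^ k)"
      by blast
  qed
  note antidiagonals = sums_antidiagonals[OF rows norm_rows this]
  note antidiagonals(2)
  \<comment> \<open>Summability of \<open>g\<close> follows from that of the rows by cancelling the
    nonzero factor \<open>(1 - t) powr (- S)\<close>.\<close>
  also have "(\<Sum>k. (1 - t) powr (- S) * g k) = (1 - t) powr (- S) * (\<Sum>k. g k)"
    using antidiagonals(1) t1 by (intro suminf_mult) (simp add: summable_cmult_iff)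
  also have "(\<lambda>n. \<Sum>k\<le>n. f k (n - k)) = (\<lambda>n. pochhammer S n / fact n *
              (\<Sum>k\<le>n. pochhammer (- of_nat n) k * pochhammer (of_nat n + S) k
                        * c k * (x ^ k / fact k)) * t ^ n)"
  proof
    fix n
    have "f k (n - k) = pochhammer S n / fact n *
            (pochhammer (- of_nat n) k * pochhammer (of_nat n + S) k * c k * (x ^ k / fact k)) * t ^ n"
      if k: "k \<le> n" for k
    proof -
      \<comment> \<open>The symbol (s)_{n+k} is split in two ways: after 2k factors, as in
        \<open>f\<close>, and after n factors, as in the Jacobi polynomial.\<close>
      have "2 * k + (n - k) = n + k"
        using k by simp
      hence "pochhammer S (2 * k) * pochhammer (S + of_nat (2 * k)) (n - k) = pochhammer S (n + k)"
        by (metis pochhammer_product')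
      also have "\<dots> = pochhammer S n * pochhammer (of_nat n + S) k"
        using pochhammer_product'[of S n k] by (simp only: add.commute)
      finally have P: "pochhammer S (2 * k) * pochhammer (S + of_nat (2 * k)) (n - k)
                     = pochhammer S n * pochhammer (of_nat n + S) k" .
      have T: "t ^ n = t ^ k * t ^ (n - k)"
        using k by (simp flip: power_add)
      have X: "(- (x * t)) ^ k = (- 1) ^ k * x ^ k * t ^ k"
        by (subst power_minus) (simp add: power_mult_distrib)
      have "f k (n - k) = c k * ((- 1) ^ k * x ^ k / fact k) * (t ^ k * t ^ (n - k)) / fact (n - k)
          * (pochhammer S (2 * k) * pochhammer (S + of_nat (2 * k)) (n - k))"
        by (simp add: f_def d_def X del: of_nat_mult)
      also have "\<dots> = pochhammer S n / fact n *
            (pochhammer (- of_nat n) k * pochhammer (of_nat n + S) k * c k * (x ^ k / fact k)) * t ^ n"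
        unfolding P T using k by (simp add: pochhammer_minus_of_nat field_simps)
      finally show ?thesis .
    qed
    thus "(\<Sum>k\<le>n. f k (n - k)) = pochhammer S n / fact n *
            (\<Sum>k\<le>n. pochhammer (- of_nat n) k * pochhammer (of_nat n + S) k
                        * c k * (x ^ k / fact k)) * t ^ n"
      unfolding sum_distrib_left sum_distrib_right by (intro sum.cong) auto
  qed
  finally show ?thesis
    by (simp add: S_def g_def)
qed

text \<open>The coefficient of a Cauchy product with exp t carries 1/(n-k)!, which is (-1)^k (-n)_k
  / n!; the sign is absorbed by the argument -xt.\<close>

lemma laguerre_generating_function:
  fixes c :: "nat \<Rightarrow> complex" and a :: real and t x :: complex
  assumes a: "a > 0" and c: "\<And>k. norm (c k) \<le> 1 / pochhammer a k"
  shows "(\<lambda>n. (\<Sum>k\<le>n. pochhammer (- of_nat n) k * c k * (x ^ k / fact k)) * (t ^ n / fact n))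
         sums (exp t * (\<Sum>k. c k * ((- (x * t)) ^ k / fact k)))"
proof -
  define f where "f k = c k * ((- (x * t)) ^ k / fact k)" for k
  have "norm (f k) \<le> 1 / (pochhammer a k * fact k) * norm (x * t) ^ k" for k
    using mult_right_mono[OF c[of k], of "norm (x * t) ^ k / fact k"]
    by (simp add: f_def norm_mult norm_divide norm_power)
  hence "summable (\<lambda>k. norm (f k))"
    by (intro summable_comparison_test[OF _ summable_0F1[OF a, of "norm (x * t)"]]) auto
  moreover have "summable (\<lambda>k. norm (t ^ k /\<^sub>R fact k))"
    by (rule summable_norm_exp)
  ultimately have "(\<lambda>n. \<Sum>k\<le>n. f k * (t ^ (n - k) /\<^sub>R fact (n - k))) sums
                     ((\<Sum>k. f k) * (\<Sum>k. t ^ k /\<^sub>R fact k))"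
    by (rule Cauchy_product_sums)
  also have "(\<lambda>n. \<Sum>k\<le>n. f k * (t ^ (n - k) /\<^sub>R fact (n - k))) =
    (\<lambda>n. (\<Sum>k\<le>n. pochhammer (- of_nat n) k * c k * (x ^ k / fact k)) * (t ^ n / fact n))"
  proof
    fix n
    have "f k * (t ^ (n - k) /\<^sub>R fact (n - k)) =
            pochhammer (- of_nat n) k * c k * (x ^ k / fact k) * (t ^ n / fact n)"
      if k: "k \<le> n" for k
    proof -
      have T: "t ^ n = t ^ k * t ^ (n - k)"
        using k by (simp flip: power_add)
      have X: "(- (x * t)) ^ k = (- 1) ^ k * x ^ k * t ^ k"
        by (subst power_minus) (simp add: power_mult_distrib)
      show ?thesis
        unfolding f_def T X using k
        by (simp add: pochhammer_minus_of_nat scaleR_conv_of_real field_simps)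
    qed
    thus "(\<Sum>k\<le>n. f k * (t ^ (n - k) /\<^sub>R fact (n - k))) =
            (\<Sum>k\<le>n. pochhammer (- of_nat n) k * c k * (x ^ k / fact k)) * (t ^ n / fact n)"
      unfolding sum_distrib_right by (intro sum.cong) auto
  qed
  finally show ?thesis
    by (simp add: f_def exp_def mult.commute)
qed

section \<open>Bound on the parameter quotient and the two expansions\<close>

text \<open>Adding the non-negative \<open>\<kappa> j\<close> to the positive base \<delta>_j + 1
  can only enlarge the Pochhammer symbol, so the products over j have quotient at most 1 and the
  symbol of \<alpha> + 1 remains.\<close>

lemma norm_param_ratio_le:
  assumes "\<forall>j\<in>{1..\<rho>}. \<delta> j > -1" and "\<alpha> > -1"
  shows "norm ((\<Prod>a\<leftarrow>upper_params \<rho> \<delta>. pochhammer a k) /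
               (\<Prod>b\<leftarrow>of_real (\<alpha> + 1) # lower_params \<rho> \<delta> \<kappa>. pochhammer b k))
         \<le> 1 / pochhammer (\<alpha> + 1) k"
proof -
  define u where "u j = pochhammer (\<delta> j + 1) k" for j
  define l where "l j = pochhammer (real (\<kappa> j) + \<delta> j + 1) k" for j
  have ul: "0 \<le> u j" "u j \<le> l j" "0 < l j" if "j \<in> {1..<Suc \<rho>}" for j
  proof -
    have "0 < \<delta> j + 1" using assms that by force
    thus "0 \<le> u j" "u j \<le> l j" "0 < l j"
      unfolding u_def l_def by (auto intro: pochhammer_mono pochhammer_pos pochhammer_nonneg)
  qed
  have "(\<Prod>a\<leftarrow>upper_params \<rho> \<delta>. pochhammer a k) = of_real (\<Prod>j=1..<Suc \<rho>. u j)"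
    by (simp add: upper_params_def o_def pochhammer_of_real u_def flip: prod.distinct_set_conv_list
        del: of_real_add of_real_1 upt_Suc)
  moreover have "(\<Prod>b\<leftarrow>of_real (\<alpha> + 1) # lower_params \<rho> \<delta> \<kappa>. pochhammer b k)
                   = of_real (pochhammer (\<alpha> + 1) k * (\<Prod>j=1..<Suc \<rho>. l j))"
    by (simp add: lower_params_def o_def pochhammer_of_real l_def flip: prod.distinct_set_conv_list
        del: of_real_add of_real_1 upt_Suc)
  moreover have "(\<Prod>j=1..<Suc \<rho>. u j) \<le> (\<Prod>j=1..<Suc \<rho>. l j)"
    using ul by (intro prod_mono) auto
  moreover have "(\<Prod>j=1..<Suc \<rho>. u j) \<ge> 0"
    using ul by (intro prod_nonneg) blast
  moreover have "(\<Prod>j=1..<Suc \<rho>. l j) > 0"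
    using ul by (intro prod_pos) blast
  moreover have "pochhammer (\<alpha> + 1) k > 0"
    using assms by (intro pochhammer_pos) auto
  ultimately show ?thesis
    by (simp add: norm_divide norm_mult divide_simps abs_mult del: upt_Suc of_real_prod of_real_mult)
qed

theorem corollary1:
  fixes \<rho> :: nat and \<delta> :: "nat \<Rightarrow> real" and \<kappa> :: "nat \<Rightarrow> nat"
  assumes "\<rho> \<ge> 1"
    and "\<forall>j\<in>{1..\<rho>}. \<delta> j > -1"
  shows "(\<forall>(c::real) (\<alpha>::real) (\<beta>::real).
            0 < c \<and> c < 1/2 \<and> \<alpha> > -1 \<and> \<beta> > -1 \<and> \<alpha> + \<beta> > -1 \<longrightarrow>
            (\<forall>(t::complex) (x::complex).
               norm t < c \<and> norm x < 1 / (4 * c) - 1/2 \<longrightarrow>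
               (\<lambda>n. pochhammer (of_real (\<alpha> + \<beta> + 1)) n / fact n
                      * gen_jacobi n x \<alpha> \<beta> \<rho> \<delta> \<kappa> * t ^ n)
               sums ((1 - t) powr of_real (- \<alpha> - \<beta> - 1)
                      * hypergeo (of_real ((\<alpha> + \<beta> + 1) / 2) # of_real ((\<alpha> + \<beta> + 2) / 2)
                                    # upper_params \<rho> \<delta>)
                                 (of_real (\<alpha> + 1) # lower_params \<rho> \<delta> \<kappa>)
                                 (- (4 * x * t / (1 - t)\<^sup>2)))))
       \<and> (\<forall>\<alpha>::real. \<alpha> > -1 \<longrightarrow>
            (\<forall>(t::complex) (x::complex).
               (\<lambda>n. gen_laguerre n x \<alpha> \<rho> \<delta> \<kappa> * (t ^ n / fact n))
               sums (exp t * hypergeo (upper_params \<rho> \<delta>)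
                                      (of_real (\<alpha> + 1) # lower_params \<rho> \<delta> \<kappa>)
                                      (- (x * t)))))"
proof (intro conjI allI impI; (elim conjE)?)
  fix c \<alpha> \<beta> :: real and t x :: complex
  assume c: "0 < c" "c < 1/2" and ab: "\<alpha> > -1" "\<beta> > -1" "\<alpha> + \<beta> > -1"
    and t: "norm t < c" and x: "norm x < 1 / (4 * c) - 1/2"
  define q where "q k = (\<Prod>a\<leftarrow>upper_params \<rho> \<delta>. pochhammer a k) /
               (\<Prod>b\<leftarrow>of_real (\<alpha> + 1) # lower_params \<rho> \<delta> \<kappa>. pochhammer b k)" for k
  \<comment> \<open>The bound on |x| times 4c is exactly 1 - 2c, which (1 - c)^2 exceeds by c^2; the
    last comparison uses |t| < c < 1.\<close>
  have "4 * norm x * norm t \<le> 4 * norm x * c"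
    using t by (intro mult_left_mono) auto
  also have "\<dots> < 1 - 2 * c"
    using x c by (simp add: field_simps)
  also have "\<dots> \<le> (1 - c)\<^sup>2"
    by (simp add: power2_diff)
  also have "\<dots> \<le> (1 - norm t)\<^sup>2"
    using t c by (intro power_mono) auto
  finally have "(\<lambda>n. pochhammer (of_real (\<alpha> + \<beta> + 1)) n / fact n *
              (\<Sum>k\<le>n. pochhammer (- of_nat n) k * pochhammer (of_nat n + of_real (\<alpha> + \<beta> + 1)) k
                        * q k * (x ^ k / fact k)) * t ^ n)
         sums ((1 - t) powr (- of_real (\<alpha> + \<beta> + 1)) *
              (\<Sum>k. pochhammer (of_real (\<alpha> + \<beta> + 1) / 2) k
                     * pochhammer ((of_real (\<alpha> + \<beta> + 1) + 1) / 2) k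
                     * q k * ((- (4 * x * t / (1 - t)\<^sup>2)) ^ k / fact k)))"
    using ab t c norm_param_ratio_le[OF assms(2) ab(1)] unfolding q_def
    by (intro jacobi_generating_function[where a = "\<alpha> + 1"]) auto
  moreover have "gen_jacobi n x \<alpha> \<beta> \<rho> \<delta> \<kappa> =
      (\<Sum>k\<le>n. pochhammer (- of_nat n) k * pochhammer (of_nat n + of_real (\<alpha> + \<beta> + 1)) k
                        * q k * (x ^ k / fact k))" for n
    unfolding gen_jacobi_def
    by (subst hypergeo_minus_nat) (auto simp: q_def add_ac mult_ac)
  moreover have "complex_of_real (- \<alpha> - \<beta> - 1) = - of_real (\<alpha> + \<beta> + 1)"
    by simp
  \<comment> \<open>A termwise identity of series, hence valid for every \<open>z\<close>; it is
    used at z = -4xt/(1-t)^2.\<close>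
  moreover have "hypergeo (of_real ((\<alpha> + \<beta> + 1) / 2) # of_real ((\<alpha> + \<beta> + 2) / 2) # upper_params \<rho> \<delta>)
                   (of_real (\<alpha> + 1) # lower_params \<rho> \<delta> \<kappa>) z =
      (\<Sum>k. pochhammer (of_real (\<alpha> + \<beta> + 1) / 2) k
             * pochhammer ((of_real (\<alpha> + \<beta> + 1) + 1) / 2) k * q k * (z ^ k / fact k))" for z
  proof -
    have "complex_of_real ((\<alpha> + \<beta> + 1) / 2) = of_real (\<alpha> + \<beta> + 1) / 2"
      "complex_of_real ((\<alpha> + \<beta> + 2) / 2) = (of_real (\<alpha> + \<beta> + 1) + 1) / 2"
      by simp_all
    thus ?thesis
      by (simp only: hypergeo_altdef q_def list.map prod_list.Cons mult.assoc times_divide_eq_right)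
  qed
  ultimately show "(\<lambda>n. pochhammer (of_real (\<alpha> + \<beta> + 1)) n / fact n
                      * gen_jacobi n x \<alpha> \<beta> \<rho> \<delta> \<kappa> * t ^ n)
               sums ((1 - t) powr of_real (- \<alpha> - \<beta> - 1)
                      * hypergeo (of_real ((\<alpha> + \<beta> + 1) / 2) # of_real ((\<alpha> + \<beta> + 2) / 2)
                                    # upper_params \<rho> \<delta>)
                                 (of_real (\<alpha> + 1) # lower_params \<rho> \<delta> \<kappa>)
                                 (- (4 * x * t / (1 - t)\<^sup>2)))"
    by (simp only:)
next
  fix \<alpha> :: real and t x :: complex
  assume \<alpha>: "\<alpha> > -1"
  define q where "q k = (\<Prod>a\<leftarrow>upper_params \<rho> \<delta>. pochhammer a k) /
               (\<Prod>b\<leftarrow>of_real (\<alpha> + 1) # lower_params \<rho> \<delta> \<kappa>. pochhammer b k)" for k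
  have "(\<lambda>n. (\<Sum>k\<le>n. pochhammer (- of_nat n) k * q k * (x ^ k / fact k)) * (t ^ n / fact n))
         sums (exp t * (\<Sum>k. q k * ((- (x * t)) ^ k / fact k)))"
    using \<alpha> norm_param_ratio_le[OF assms(2) \<alpha>] unfolding q_def
    by (intro laguerre_generating_function[where a = "\<alpha> + 1"]) auto
  moreover have "gen_laguerre n x \<alpha> \<rho> \<delta> \<kappa> =
      (\<Sum>k\<le>n. pochhammer (- of_nat n) k * q k * (x ^ k / fact k))" for n
    unfolding gen_laguerre_def by (subst hypergeo_minus_nat) (auto simp: q_def)
  ultimately show "(\<lambda>n. gen_laguerre n x \<alpha> \<rho> \<delta> \<kappa> * (t ^ n / fact n))
               sums (exp t * hypergeo (upper_params \<rho> \<delta>)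
                                      (of_real (\<alpha> + 1) # lower_params \<rho> \<delta> \<kappa>)
                                      (- (x * t)))"
    by (simp add: hypergeo_altdef q_def)
qed

end
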